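(* Let $\alpha$ be a finite set, $\tau$ an involution on $\alpha$, $S\subseteq\alpha\times\alpha\times\alpha$, and $r$ a positive integer. The linking matrix $p\mapsto L(p)$ of $r$-component nanophrases over $\alpha$, under the homotopy given by $(\alpha,\tau,S)$, is a degree $1$ finite type invariant.
   Context: Nanophrases and homotopy. An $r$-component Gauss phrase is a sequence of $r$ (possibly empty) finite words, written separated by the symbol $|$, such that every letter occurring in it occurs exactly twice in total. An $r$-component nanophrase over $\alpha$ is an $r$-component Gauss phrase $p$ together with a map $A\mapsto |A|$ from the set of letters appearing in $p$ to $\alpha$. Two nanophrases are isomorphic if a bijection of their letter sets preserving the map to $\alpha$ carries one Gauss phrase to the other letterwise. The homotopy given by $(\alpha,\tau,S)$ is the equivalence relation on $r$-component nanophrases generated by isomorphism and the moves (in both directions) H1: $xAAy\leftrightarrow xy$; H2: $xAByBAz\leftrightarrow xyz$ if $|A|=\tau(|B|)$; H3: $xAByACzBCt\leftrightarrow xBAyCAzCBt$ if $(|A|,|B|,|C|)\in S$; here $x,y,z,t$ are arbitrary sequences of letters, possibly including $|$, such that both sides are nanophrases, and all remaining letters keep their images in $\alpha$. An involution is a map $\tau$ with $\tau\circ\tau=\mathrm{id}$. Finite type invariants. $P(\alpha,\tau,S,r)$ is the set of homotopy classes of $r$-component nanophrases and $\mathbb{Z}P(\alpha,\tau,S,r)$ the free abelian group generated by it. A homotopy invariant is a function on $P(\alpha,\tau,S,r)$ with values in an additive abelian group, extended linearly to $\mathbb{Z}P(\alpha,\tau,S,r)$. A nanophrase in which a letter $A$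 is marked as a semi-letter $\dot A$ denotes the formal sum $x\dot Ay\dot Az=xAyAz-xyz$; applied recursively, this defines nanophrases with any number of semi-letters as elements of $\mathbb{Z}P(\alpha,\tau,S,r)$. A homotopy invariant $v$ is a finite type invariant if there is an integer $n$ such that $v(p)=0$ for every nanophrase $p$ with more than $n$ semi-letters; the least such $n$ is the degree of $v$. Linking matrix. $\pi$ is the abelian group (written additively) generated by the elements of $\alpha$ with relations $a+\tau(a)=0$ for all $a\in\alpha$. For an $r$-component nanophrase $p$ let $\mathcal{A}_{ij}(p)$ be the set of letters with one occurrence in the $i$th component and the other in the $j$th component. Put $l_{ii}(p)=0$ and $l_{ij}(p)=\sum_{X\in\mathcal{A}_{ij}(p)}|X|\in\pi$ for $i\neq j$, where $1\le i,j\le r$. $L(p)$ is the symmetric $r\times r$ matrix $(l_{ij}(p))$. It is known to be a homotopy invariant under any homotopy of nanophrases.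
   Formalization: For r = 1 or empty α the linking matrix is identically zero, so its degree is not 1; the formal theorem states finite type with degree at most 1 in all cases, and degree exactly 1 when r ≥ 2 and α is nonempty. *)

theory Defs
  imports "HOL-Algebra.Algebra"
begin

section \<open>Nanophrases\<close>

text \<open>A phrase is one sequence of symbols in which \<open>Bar\<close> separates consecutive components,
  so an \<open>r\<close>-component phrase (\<open>r \<ge> 1\<close>) contains \<open>r - 1\<close> bars. Phrases only matter up to renaming
  of letters, so a countable supply of letters is enough.\<close>

datatype 'l symbol = Letter 'l | Bar

type_synonym phrase = "nat symbol list"

definition letters :: "phrase \<Rightarrow> nat set" where
  "letters w = {A. Letter A \<in> set w}"

definition gauss_phrase :: "nat \<Rightarrow> phrase \<Rightarrow> bool" where
  "gauss_phrase r w \<longleftrightarrow>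
     count_list w Bar + 1 = r \<and> (\<forall>A\<in>letters w. count_list w (Letter A) = 2)"

text \<open>The domain of the partial map is exactly the set of letters of the phrase, so that
  equality of pairs is equality of nanophrases.\<close>

type_synonym 'a nanophrase = "phrase \<times> (nat \<rightharpoonup> 'a)"

definition nanophrases :: "'a set \<Rightarrow> nat \<Rightarrow> 'a nanophrase set" where
  "nanophrases \<alpha> r = {(w, f). gauss_phrase r w \<and> dom f = letters w \<and> ran f \<subseteq> \<alpha>}"


section \<open>Homotopy\<close>

text \<open>Isomorphism and the three moves, each in one direction. In the moves \<open>x\<close>, \<open>y\<close>, \<open>z\<close>, \<open>t\<close>
  may contain bars. That both sides are nanophrases is imposed in \<open>homotopy\<close> below; it forces
  the displayed letters to be distinct from each other and from all the others.\<close>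

inductive homotopy_move ::
  "('a \<Rightarrow> 'a) \<Rightarrow> ('a \<times> 'a \<times> 'a) set \<Rightarrow> 'a nanophrase \<Rightarrow> 'a nanophrase \<Rightarrow> bool"
  for \<tau> S where
  isomorphism:
    "bij_betw h (letters w) (letters w') \<Longrightarrow> w' = map (map_symbol h) w \<Longrightarrow>
     (\<And>A. A \<in> letters w \<Longrightarrow> f' (h A) = f A) \<Longrightarrow>
     homotopy_move \<tau> S (w, f) (w', f')"
| H1:
    "homotopy_move \<tau> S
       (x @ [Letter A, Letter A] @ y, f)
       (x @ y, f |` (- {A}))"
| H2:
    "f A = Some a \<Longrightarrow> f B = Some b \<Longrightarrow> a = \<tau> b \<Longrightarrow>
     homotopy_move \<tau> S
       (x @ [Letter A, Letter B] @ y @ [Letter B, Letter A] @ z, f)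
       (x @ y @ z, f |` (- {A, B}))"
| H3:
    "f A = Some a \<Longrightarrow> f B = Some b \<Longrightarrow> f C = Some c \<Longrightarrow> (a, b, c) \<in> S \<Longrightarrow>
     homotopy_move \<tau> S
       (x @ [Letter A, Letter B] @ y @ [Letter A, Letter C] @ z @ [Letter B, Letter C] @ t, f)
       (x @ [Letter B, Letter A] @ y @ [Letter C, Letter A] @ z @ [Letter C, Letter B] @ t, f)"

definition homotopy ::
  "'a set \<Rightarrow> ('a \<Rightarrow> 'a) \<Rightarrow> ('a \<times> 'a \<times> 'a) set \<Rightarrow> nat \<Rightarrow> ('a nanophrase \<times> 'a nanophrase) set" where
  "homotopy \<alpha> \<tau> S r =
     {(p, q). p \<in> nanophrases \<alpha> r \<and> q \<in> nanophrases \<alpha> r \<and>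
        equivclp (\<lambda>p q. p \<in> nanophrases \<alpha> r \<and> q \<in> nanophrases \<alpha> r \<and> homotopy_move \<tau> S p q) p q}"

definition homotopy_classes ::
  "'a set \<Rightarrow> ('a \<Rightarrow> 'a) \<Rightarrow> ('a \<times> 'a \<times> 'a) set \<Rightarrow> nat \<Rightarrow> 'a nanophrase set set" where
  "homotopy_classes \<alpha> \<tau> S r = nanophrases \<alpha> r // homotopy \<alpha> \<tau> S r"

definition homotopy_class ::
  "'a set \<Rightarrow> ('a \<Rightarrow> 'a) \<Rightarrow> ('a \<times> 'a \<times> 'a) set \<Rightarrow> nat \<Rightarrow> 'a nanophrase \<Rightarrow> 'a nanophrase set" where
  "homotopy_class \<alpha> \<tau> S r p = homotopy \<alpha> \<tau> S r `` {p}"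


section \<open>Finite type invariants\<close>

text \<open>The free abelian group on the homotopy classes is
  \<open>free_Abelian_group (homotopy_classes \<alpha> \<tau> S r)\<close>, whose elements are finitely supported
  integer-valued functions and whose addition is \<open>+\<close>.\<close>

definition delete_letter :: "nat \<Rightarrow> 'a nanophrase \<Rightarrow> 'a nanophrase" where
  "delete_letter A p = (filter (\<lambda>s. s \<noteq> Letter A) (fst p), snd p |` (- {A}))"

text \<open>\<open>semi \<alpha> \<tau> S r p As\<close> is the nanophrase \<open>p\<close> with the letters in the (distinct) list \<open>As\<close>
  marked as semi-letters, an element of the free abelian group.\<close>

fun semi ::
  "'a set \<Rightarrow> ('a \<Rightarrow> 'a) \<Rightarrow> ('a \<times> 'a \<times> 'a) set \<Rightarrow> nat \<Rightarrow> 'a nanophrase \<Rightarrow> nat list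
     \<Rightarrow> 'a nanophrase set \<Rightarrow>\<^sub>0 int" where
  "semi \<alpha> \<tau> S r p [] = frag_of (homotopy_class \<alpha> \<tau> S r p)"
| "semi \<alpha> \<tau> S r p (A # As) = semi \<alpha> \<tau> S r p As - semi \<alpha> \<tau> S r (delete_letter A p) As"

text \<open>Abelian groups of values are \<open>comm_group\<close>s, hence in multiplicative notation. A homotopy
  invariant is given as a function on nanophrases that is constant on homotopy classes; \<open>on_class\<close>
  is the induced function on classes and \<open>linear_extension\<close> its extension to integer
  combinations of classes.\<close>

definition homotopy_invariant ::
  "'a set \<Rightarrow> ('a \<Rightarrow> 'a) \<Rightarrow> ('a \<times> 'a \<times> 'a) set \<Rightarrow> nat \<Rightarrow> 'b monoid \<Rightarrow> ('a nanophrase \<Rightarrow> 'b) \<Rightarrow> bool"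
  where
  "homotopy_invariant \<alpha> \<tau> S r G v \<longleftrightarrow>
     comm_group G \<and> v \<in> nanophrases \<alpha> r \<rightarrow> carrier G \<and>
     (\<forall>(p, q)\<in>homotopy \<alpha> \<tau> S r. v p = v q)"

definition on_class :: "('a nanophrase \<Rightarrow> 'b) \<Rightarrow> 'a nanophrase set \<Rightarrow> 'b" where
  "on_class v c = the_elem (v ` c)"

definition linear_extension ::
  "'b monoid \<Rightarrow> ('a nanophrase \<Rightarrow> 'b) \<Rightarrow> ('a nanophrase set \<Rightarrow>\<^sub>0 int) \<Rightarrow> 'b" where
  "linear_extension G v u =
     finprod G (\<lambda>c. on_class v c [^]\<^bsub>G\<^esub> Poly_Mapping.lookup u c) (Poly_Mapping.keys u)"

definition vanishes_above ::
  "'a set \<Rightarrow> ('a \<Rightarrow> 'a) \<Rightarrow> ('a \<times> 'a \<times> 'a) set \<Rightarrow> nat \<Rightarrow> 'b monoid \<Rightarrow> ('a nanophrase \<Rightarrow> 'b)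
     \<Rightarrow> nat \<Rightarrow> bool" where
  "vanishes_above \<alpha> \<tau> S r G v n \<longleftrightarrow>
     (\<forall>p\<in>nanophrases \<alpha> r. \<forall>As. distinct As \<and> set As \<subseteq> letters (fst p) \<and> n < length As \<longrightarrow>
        linear_extension G v (semi \<alpha> \<tau> S r p As) = \<one>\<^bsub>G\<^esub>)"

definition finite_type_invariant ::
  "'a set \<Rightarrow> ('a \<Rightarrow> 'a) \<Rightarrow> ('a \<times> 'a \<times> 'a) set \<Rightarrow> nat \<Rightarrow> 'b monoid \<Rightarrow> ('a nanophrase \<Rightarrow> 'b) \<Rightarrow> bool"
  where
  "finite_type_invariant \<alpha> \<tau> S r G v \<longleftrightarrow>
     homotopy_invariant \<alpha> \<tau> S r G v \<and> (\<exists>n. vanishes_above \<alpha> \<tau> S r G v n)"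

text \<open>The degree is a natural number, so the zero invariant has degree \<open>0\<close>.\<close>

definition invariant_degree ::
  "'a set \<Rightarrow> ('a \<Rightarrow> 'a) \<Rightarrow> ('a \<times> 'a \<times> 'a) set \<Rightarrow> nat \<Rightarrow> 'b monoid \<Rightarrow> ('a nanophrase \<Rightarrow> 'b) \<Rightarrow> nat"
  where
  "invariant_degree \<alpha> \<tau> S r G v = (LEAST n. vanishes_above \<alpha> \<tau> S r G v n)"


section \<open>The linking matrix\<close>

definition linking_relations :: "'a set \<Rightarrow> ('a \<Rightarrow> 'a) \<Rightarrow> ('a \<Rightarrow>\<^sub>0 int) set" where
  "linking_relations \<alpha> \<tau> =
     generate (free_Abelian_group \<alpha>) {frag_of a + frag_of (\<tau> a) | a. a \<in> \<alpha>}"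

definition linking_group :: "'a set \<Rightarrow> ('a \<Rightarrow> 'a) \<Rightarrow> ('a \<Rightarrow>\<^sub>0 int) set monoid" where
  "linking_group \<alpha> \<tau> = free_Abelian_group \<alpha> Mod linking_relations \<alpha> \<tau>"

definition generator :: "'a set \<Rightarrow> ('a \<Rightarrow> 'a) \<Rightarrow> 'a \<Rightarrow> ('a \<Rightarrow>\<^sub>0 int) set" where
  "generator \<alpha> \<tau> a = linking_relations \<alpha> \<tau> #>\<^bsub>free_Abelian_group \<alpha>\<^esub> frag_of a"

text \<open>The component (numbered from 1) containing position \<open>k\<close> of a phrase.\<close>

definition component_of :: "phrase \<Rightarrow> nat \<Rightarrow> nat" where
  "component_of w k = count_list (take k w) Bar + 1"

definition shared_letters :: "phrase \<Rightarrow> nat \<Rightarrow> nat \<Rightarrow> nat set" where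
  "shared_letters w i j =
     {A. \<exists>k l. k < length w \<and> l < length w \<and> k \<noteq> l \<and> w ! k = Letter A \<and> w ! l = Letter A \<and>
           component_of w k = i \<and> component_of w l = j}"

definition linking_number ::
  "'a set \<Rightarrow> ('a \<Rightarrow> 'a) \<Rightarrow> 'a nanophrase \<Rightarrow> nat \<Rightarrow> nat \<Rightarrow> ('a \<Rightarrow>\<^sub>0 int) set" where
  "linking_number \<alpha> \<tau> p i j =
     (if i = j then \<one>\<^bsub>linking_group \<alpha> \<tau>\<^esub>
      else finprod (linking_group \<alpha> \<tau>) (\<lambda>A. generator \<alpha> \<tau> (the (snd p A)))
             (shared_letters (fst p) i j))"

text \<open>The \<open>r \<times> r\<close> matrices over the linking group, under entrywise addition.\<close>

definition linking_matrix_group ::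
  "'a set \<Rightarrow> ('a \<Rightarrow> 'a) \<Rightarrow> nat \<Rightarrow> (nat \<times> nat \<Rightarrow> ('a \<Rightarrow>\<^sub>0 int) set) monoid" where
  "linking_matrix_group \<alpha> \<tau> r = product_group ({1..r} \<times> {1..r}) (\<lambda>_. linking_group \<alpha> \<tau>)"

definition linking_matrix ::
  "'a set \<Rightarrow> ('a \<Rightarrow> 'a) \<Rightarrow> nat \<Rightarrow> 'a nanophrase \<Rightarrow> (nat \<times> nat \<Rightarrow> ('a \<Rightarrow>\<^sub>0 int) set)" where
  "linking_matrix \<alpha> \<tau> r p = (\<lambda>(i, j)\<in>{1..r} \<times> {1..r}. linking_number \<alpha> \<tau> p i j)"

end

theory Submission
  imports Defs
begin

text \<open>A linking number is a sum over letters: for \<open>i \<noteq> j\<close> the letter \<open>A\<close> contributes \<open>|A|\<close> to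
  \<open>l\<^sub>i\<^sub>j\<close> if it occurs in both components, and nothing otherwise. Deleting another letter changes
  neither the value of \<open>A\<close> nor the components in which it occurs, so the difference
  \<open>L(p) - L(p with A deleted)\<close> is the contribution of \<open>A\<close> alone and is the same before and after
  deleting \<open>B\<close>. All second differences of \<open>L\<close> therefore vanish
  (\<open>linking_number_second_difference\<close>), and since every additional semi-letter takes one more
  difference, \<open>L\<close> vanishes on two or more semi-letters (\<open>vanishes_above_1I\<close>).

  Homotopy invariance follows from the same description (\<open>linking_number_move\<close>). The moves H1
  and H2 delete letters: the letter of H1 has both occurrences in one component and contributes
  nothing, the two letters of H2 occur in the same components and their contributions \<open>\<tau> b\<close> and
  \<open>b\<close> cancel. The move H3 only exchanges neighbouring letters, hence leaves the set of letters of
  each component alone, and an isomorphism reindexes the sum.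

  The degree is not \<open>0\<close> when there are at least two components and a value \<open>a\<close>: the phrase \<open>A|...|A\<close>
  with \<open>|A| = a\<close> and the phrase without letters differ in \<open>l\<^sub>1\<^sub>r\<close> by the generator \<open>a\<close>, which is
  not zero in \<open>\<pi>\<close>, because every relation \<open>b + \<tau>(b)\<close> has even total coefficient
  (\<open>generator_nontrivial\<close>).\<close>

section \<open>Linear extensions\<close>

text \<open>Products over the keys of different combinations can only be multiplied once they range over
  a common index set.\<close>

lemma linear_extension_superset:
  assumes "comm_group G" and K: "finite K" "Poly_Mapping.keys u \<subseteq> K"
    and v: "on_class v \<in> K \<rightarrow> carrier G"
  shows "linear_extension G v u =
           finprod G (\<lambda>c. on_class v c [^]\<^bsub>G\<^esub> Poly_Mapping.lookup u c) K"
proof -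
  interpret comm_group G by fact
  show ?thesis
    unfolding linear_extension_def
  proof (rule finprod_mono_neutral_cong_left)
    show "on_class v c [^]\<^bsub>G\<^esub> Poly_Mapping.lookup u c = \<one>\<^bsub>G\<^esub>"
      if "c \<in> K - Poly_Mapping.keys u" for c
      using that by (simp add: in_keys_iff)
  qed (use K v in auto)
qed

lemma linear_extension_diff:
  assumes "comm_group G"
    and v: "on_class v \<in> Poly_Mapping.keys u \<union> Poly_Mapping.keys w \<rightarrow> carrier G"
  shows "linear_extension G v (u - w) =
           linear_extension G v u \<otimes>\<^bsub>G\<^esub> inv\<^bsub>G\<^esub> linear_extension G v w"
proof -
  interpret comm_group G by fact
  let ?K = "Poly_Mapping.keys u \<union> Poly_Mapping.keys w"
  define F where
    "F u = finprod G (\<lambda>c. on_class v c [^]\<^bsub>G\<^esub> (Poly_Mapping.lookup u c :: int)) ?K" for u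
  have le: "linear_extension G v u' = F u'" if "Poly_Mapping.keys u' \<subseteq> ?K" for u'
    unfolding F_def using linear_extension_superset[OF assms(1) _ that v] by simp
  have pow: "(\<lambda>c. on_class v c [^]\<^bsub>G\<^esub> (Poly_Mapping.lookup u' c :: int)) \<in> ?K \<rightarrow> carrier G" for u'
    using v by auto
  have closed: "F u' \<in> carrier G" for u'
    unfolding F_def using pow by (rule finprod_closed)
  have "F (u - w) \<otimes>\<^bsub>G\<^esub> F w =
        finprod G (\<lambda>c. on_class v c [^]\<^bsub>G\<^esub> Poly_Mapping.lookup (u - w) c \<otimes>\<^bsub>G\<^esub>
                       on_class v c [^]\<^bsub>G\<^esub> Poly_Mapping.lookup w c) ?K"
    unfolding F_def using finprod_multf[OF pow pow] by simp
  also have "\<dots> = F u"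
    unfolding F_def
  proof (rule finprod_cong')
    show "on_class v c [^]\<^bsub>G\<^esub> Poly_Mapping.lookup (u - w) c \<otimes>\<^bsub>G\<^esub>
            on_class v c [^]\<^bsub>G\<^esub> Poly_Mapping.lookup w c =
          on_class v c [^]\<^bsub>G\<^esub> Poly_Mapping.lookup u c" if "c \<in> ?K" for c
    proof -
      have "on_class v c \<in> carrier G" using that v by auto
      then show ?thesis
        by (simp add: Poly_Mapping.lookup_minus flip: int_pow_mult)
    qed
  qed (use pow in auto)
  finally have "F (u - w) \<otimes>\<^bsub>G\<^esub> F w = F u" .
  then have "F (u - w) = F u \<otimes>\<^bsub>G\<^esub> inv\<^bsub>G\<^esub> F w"
    using closed inv_solve_right by metis
  then show ?thesis
    using le[of u] le[of w] le[of "u - w"] keys_diff[of u w] by auto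
qed

lemma homotopy_refl: "p \<in> nanophrases \<alpha> r \<Longrightarrow> (p, p) \<in> homotopy \<alpha> \<tau> S r"
  by (simp add: homotopy_def)

lemma on_class_homotopy_class:
  assumes "homotopy_invariant \<alpha> \<tau> S r G v" "p \<in> nanophrases \<alpha> r"
  shows "on_class v (homotopy_class \<alpha> \<tau> S r p) = v p"
proof -
  have "v ` homotopy_class \<alpha> \<tau> S r p = {v p}"
    using assms homotopy_refl[OF assms(2), of \<tau> S]
    by (fastforce simp: homotopy_class_def homotopy_invariant_def)
  then show ?thesis
    by (simp add: on_class_def)
qed

lemma on_class_closed:
  assumes "homotopy_invariant \<alpha> \<tau> S r G v"
  shows "on_class v \<in> homotopy_classes \<alpha> \<tau> S r \<rightarrow> carrier G"
proof
  fix c assume "c \<in> homotopy_classes \<alpha> \<tau> S r"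
  then obtain p where "p \<in> nanophrases \<alpha> r" "c = homotopy_class \<alpha> \<tau> S r p"
    by (auto simp: homotopy_classes_def homotopy_class_def elim: quotientE)
  then show "on_class v c \<in> carrier G"
    using assms by (auto simp: on_class_homotopy_class homotopy_invariant_def)
qed

lemma homotopy_invariantI:
  assumes "comm_group G" "v \<in> nanophrases \<alpha> r \<rightarrow> carrier G"
    and moves: "\<And>p q. p \<in> nanophrases \<alpha> r \<Longrightarrow> q \<in> nanophrases \<alpha> r \<Longrightarrow>
                  homotopy_move \<tau> S p q \<Longrightarrow> v p = v q"
  shows "homotopy_invariant \<alpha> \<tau> S r G v"
proof -
  have "v p = v q"
    if "equivclp (\<lambda>p q. p \<in> nanophrases \<alpha> r \<and> q \<in> nanophrases \<alpha> r \<and> homotopy_move \<tau> S p q) p q"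
    for p q
    using that by (induction rule: equivclp_induct) (auto dest: moves)
  then show ?thesis
    using assms(1,2) by (auto simp: homotopy_invariant_def homotopy_def)
qed

section \<open>Deleting a letter\<close>

lemma count_list_filter: "count_list (filter P w) s = (if P s then count_list w s else 0)"
  by (induction w) auto

lemma letters_filter: "letters (filter (\<lambda>s. s \<noteq> Letter A) w) = letters w - {A}"
  by (auto simp: letters_def)

lemma finite_letters: "finite (letters w)"
proof -
  have "letters w = Letter -` set w"
    by (auto simp: letters_def)
  then show ?thesis
    by (simp add: finite_vimageI inj_def)
qed

lemma letters_delete_letter: "letters (fst (delete_letter A p)) = letters (fst p) - {A}"
  by (simp add: delete_letter_def letters_filter)

lemma delete_letter_nanophrase:
  assumes "p \<in> nanophrases \<alpha> r"
  shows "delete_letter A p \<in> nanophrases \<alpha> r"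
proof -
  obtain w f where p: "p = (w, f)" by (cases p)
  have "ran (f |` (- {A})) \<subseteq> ran f"
    by (auto simp: ran_def restrict_map_def split: if_splits)
  then show ?thesis
    using assms
    by (auto simp: p delete_letter_def nanophrases_def gauss_phrase_def letters_filter
          count_list_filter)
qed

text \<open>Outside the homotopy classes \<open>on_class\<close> takes unspecified values, so additivity of the linear
  extension is only available for combinations of genuine classes.\<close>

lemma keys_semi:
  assumes "p \<in> nanophrases \<alpha> r"
  shows "Poly_Mapping.keys (semi \<alpha> \<tau> S r p As) \<subseteq> homotopy_classes \<alpha> \<tau> S r"
  using assms
proof (induction As arbitrary: p)
  case Nil
  then show ?case
    by (auto simp: homotopy_classes_def homotopy_class_def intro: quotientI)
next
  case (Cons A As)
  then have "Poly_Mapping.keys (semi \<alpha> \<tau> S r p As) \<subseteq> homotopy_classes \<alpha> \<tau> S r"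
      "Poly_Mapping.keys (semi \<alpha> \<tau> S r (delete_letter A p) As) \<subseteq> homotopy_classes \<alpha> \<tau> S r"
    by (simp_all add: delete_letter_nanophrase)
  then show ?case
    using keys_diff[of "semi \<alpha> \<tau> S r p As" "semi \<alpha> \<tau> S r (delete_letter A p) As"] by auto
qed

lemma linear_extension_semi_Nil:
  assumes "homotopy_invariant \<alpha> \<tau> S r G v" "p \<in> nanophrases \<alpha> r"
  shows "linear_extension G v (semi \<alpha> \<tau> S r p []) = v p"
proof -
  interpret comm_group G using assms by (simp add: homotopy_invariant_def)
  have "v p \<in> carrier G" using assms by (auto simp: homotopy_invariant_def)
  then show ?thesis
    using assms by (simp add: linear_extension_def on_class_homotopy_class finprod_singleton)
qed

text \<open>A semi-letter acts on an invariant as a difference operator.\<close>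

lemma linear_extension_semi_Cons:
  assumes "homotopy_invariant \<alpha> \<tau> S r G v" "p \<in> nanophrases \<alpha> r"
  shows "linear_extension G v (semi \<alpha> \<tau> S r p (A # As)) =
           linear_extension G v (semi \<alpha> \<tau> S r p As) \<otimes>\<^bsub>G\<^esub>
           inv\<^bsub>G\<^esub> linear_extension G v (semi \<alpha> \<tau> S r (delete_letter A p) As)"
proof -
  have "on_class v \<in> Poly_Mapping.keys (semi \<alpha> \<tau> S r p As) \<union>
          Poly_Mapping.keys (semi \<alpha> \<tau> S r (delete_letter A p) As) \<rightarrow> carrier G"
    using on_class_closed[OF assms(1)] keys_semi[OF assms(2), of \<tau> S As]
      keys_semi[OF delete_letter_nanophrase[OF assms(2)], of \<tau> S A As]
    by auto
  then show ?thesis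
    using assms(1) by (simp add: linear_extension_diff homotopy_invariant_def)
qed

section \<open>Invariants of degree at most one\<close>

text \<open>This lets the vanishing of second differences be checked without inverses, by comparing
  products of matrices entry by entry.\<close>

lemma (in comm_group) difference_eqI:
  assumes "a \<otimes> d = c \<otimes> b" and [simp]: "a \<in> carrier G" "c \<in> carrier G" "b \<in> carrier G" "d \<in> carrier G"
  shows "a \<otimes> inv b = c \<otimes> inv d"
proof -
  have "a = (c \<otimes> b) \<otimes> inv d"
    using assms(1) by (simp add: inv_solve_right)
  also have "\<dots> = (c \<otimes> inv d) \<otimes> b"
    by (simp add: m_ac)
  finally show ?thesis
    by (simp add: inv_solve_right')
qed

text \<open>Two semi-letters give the second difference of the invariant, and every further one gives a
  difference of two combinations that vanish already. Hence only pairs of letters need to be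
  examined.\<close>

lemma vanishes_above_1I:
  assumes v: "homotopy_invariant \<alpha> \<tau> S r G v"
    and second_difference:
      "\<And>p A B. p \<in> nanophrases \<alpha> r \<Longrightarrow> A \<in> letters (fst p) \<Longrightarrow> B \<in> letters (fst p) \<Longrightarrow> A \<noteq> B \<Longrightarrow>
         v p \<otimes>\<^bsub>G\<^esub> v (delete_letter B (delete_letter A p)) =
         v (delete_letter A p) \<otimes>\<^bsub>G\<^esub> v (delete_letter B p)"
  shows "vanishes_above \<alpha> \<tau> S r G v 1"
proof -
  interpret comm_group G using v by (simp add: homotopy_invariant_def)
  have closed: "v p \<in> carrier G" if "p \<in> nanophrases \<alpha> r" for p
    using v that by (auto simp: homotopy_invariant_def)
  have "linear_extension G v (semi \<alpha> \<tau> S r p As) = \<one>\<^bsub>G\<^esub>"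
    if "p \<in> nanophrases \<alpha> r" "distinct As" "set As \<subseteq> letters (fst p)" "1 < length As" for p As
    using that
  proof (induction As arbitrary: p)
    case (Cons A As)
    let ?p = "delete_letter A p"
    have p': "?p \<in> nanophrases \<alpha> r"
      using Cons.prems by (simp add: delete_letter_nanophrase)
    show ?case
    proof (cases "1 < length As")
      case True
      then have "linear_extension G v (semi \<alpha> \<tau> S r p As) = \<one>\<^bsub>G\<^esub>"
          "linear_extension G v (semi \<alpha> \<tau> S r ?p As) = \<one>\<^bsub>G\<^esub>"
        using Cons.IH[of p] Cons.IH[of ?p] Cons.prems p'
        by (simp_all add: letters_delete_letter subset_Diff_insert)
      then show ?thesis
        using Cons.prems by (simp del: semi.simps add: linear_extension_semi_Cons[OF v])
    next
      case False
      then obtain B where As: "As = [B]"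
        using Cons.prems by (cases As) auto
      have "v p \<otimes>\<^bsub>G\<^esub> v (delete_letter B ?p) = v ?p \<otimes>\<^bsub>G\<^esub> v (delete_letter B p)"
        using second_difference[of p A B] Cons.prems As by simp
      moreover have "v p \<in> carrier G" "v ?p \<in> carrier G" "v (delete_letter B p) \<in> carrier G"
          "v (delete_letter B ?p) \<in> carrier G"
        using Cons.prems by (simp_all add: closed delete_letter_nanophrase)
      ultimately have "v p \<otimes>\<^bsub>G\<^esub> inv\<^bsub>G\<^esub> v (delete_letter B p) =
          v ?p \<otimes>\<^bsub>G\<^esub> inv\<^bsub>G\<^esub> v (delete_letter B ?p)"
        by (rule difference_eqI)
      then show ?thesis
        using Cons.prems p' by (simp del: semi.simps add: As linear_extension_semi_Cons[OF v]
            linear_extension_semi_Nil[OF v] delete_letter_nanophrase closed)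
    qed
  qed simp
  then show ?thesis
    by (simp add: vanishes_above_def)
qed

section \<open>The letters of a component\<close>

text \<open>Components are numbered from \<open>0\<close> here, which makes the recursion over the phrase and the
  concatenation rule free of boundary cases; component \<open>i\<close> is the one that \<open>component_of\<close>
  numbers \<open>Suc i\<close>.\<close>

fun component_letters :: "phrase \<Rightarrow> nat \<Rightarrow> nat set" where
  "component_letters [] i = {}"
| "component_letters (Letter A # w) i = (if i = 0 then {A} else {}) \<union> component_letters w i"
| "component_letters (Bar # w) i = (case i of 0 \<Rightarrow> {} | Suc j \<Rightarrow> component_letters w j)"

lemma mem_component_letters_iff:
  "A \<in> component_letters w i \<longleftrightarrow>
     (\<exists>k<length w. w ! k = Letter A \<and> count_list (take k w) Bar = i)"
proof (induction w i rule: component_letters.induct)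
  case (2 B w i)
  then show ?case
    by (auto simp: Ex_less_Suc2)
next
  case (3 w i)
  then show ?case
    by (auto simp: Ex_less_Suc2 split: nat.split)
qed simp

text \<open>For different components the two occurrences of a shared letter are at different positions
  automatically, so sharing becomes an intersection of two sets that are computed separately.\<close>

lemma shared_letters_eq:
  assumes "i \<noteq> j"
  shows "shared_letters w (Suc i) (Suc j) = component_letters w i \<inter> component_letters w j"
proof
  show "shared_letters w (Suc i) (Suc j) \<subseteq> component_letters w i \<inter> component_letters w j"
    by (auto simp: shared_letters_def component_of_def mem_component_letters_iff)
  show "component_letters w i \<inter> component_letters w j \<subseteq> shared_letters w (Suc i) (Suc j)"
  proof
    fix A assume "A \<in> component_letters w i \<inter> component_letters w j"
    then obtain k l where kl: "k < length w" "w ! k = Letter A" "count_list (take k w) Bar = i"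
      "l < length w" "w ! l = Letter A" "count_list (take l w) Bar = j"
      by (auto simp: mem_component_letters_iff)
    then have "k \<noteq> l" using assms by blast
    then show "A \<in> shared_letters w (Suc i) (Suc j)"
      unfolding shared_letters_def component_of_def using kl by auto
  qed
qed

lemma component_letters_subset: "component_letters w i \<subseteq> letters w"
  by (auto simp: mem_component_letters_iff letters_def) (metis nth_mem)

lemma component_letters_append:
  "component_letters (u @ w) i =
     component_letters u i \<union>
     (if count_list u Bar \<le> i then component_letters w (i - count_list u Bar) else {})"
  by (induction u i rule: component_letters.induct) (auto split: nat.split)

lemma mem_component_letters_append:
  "A \<in> component_letters (u @ w) i \<longleftrightarrow>
     A \<in> component_letters u i \<or>
     count_list u Bar \<le> i \<and> A \<in> component_letters w (i - count_list u Bar)"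
  by (simp add: component_letters_append)

lemma mem_component_letters_Letter:
  "A \<in> component_letters (Letter B # w) i \<longleftrightarrow> i = 0 \<and> A = B \<or> A \<in> component_letters w i"
  by simp

lemma component_letters_filter:
  "component_letters (filter (\<lambda>s. s \<noteq> Letter A) w) i = component_letters w i - {A}"
  by (induction w i rule: component_letters.induct) (auto split: nat.split)

lemma component_letters_map:
  "component_letters (map (map_symbol h) w) i = h ` component_letters w i"
  by (induction w i rule: component_letters.induct) (auto split: nat.split)

section \<open>The linking group\<close>

lemma linking_relations_subgroup:
  assumes "\<tau> \<in> \<alpha> \<rightarrow> \<alpha>"
  shows "subgroup (linking_relations \<alpha> \<tau>) (free_Abelian_group \<alpha>)"
  unfolding linking_relations_def
proof (rule group.generate_is_subgroup)
  show "{frag_of a + frag_of (\<tau> a) |a. a \<in> \<alpha>} \<subseteq> carrier (free_Abelian_group \<alpha>)"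
    using assms keys_add[of "frag_of _" "frag_of _"] by fastforce
qed simp

lemma linking_relations_normal:
  assumes "\<tau> \<in> \<alpha> \<rightarrow> \<alpha>"
  shows "linking_relations \<alpha> \<tau> \<lhd> free_Abelian_group \<alpha>"
  using assms
  by (intro comm_group.subgroup_imp_normal abelian_free_Abelian_group linking_relations_subgroup)

lemma comm_group_linking_group:
  assumes "\<tau> \<in> \<alpha> \<rightarrow> \<alpha>"
  shows "comm_group (linking_group \<alpha> \<tau>)"
  unfolding linking_group_def
  using assms
  by (intro comm_group.abelian_FactGroup abelian_free_Abelian_group linking_relations_subgroup)

lemma generator_closed:
  assumes "\<tau> \<in> \<alpha> \<rightarrow> \<alpha>" "a \<in> \<alpha>"
  shows "generator \<alpha> \<tau> a \<in> carrier (linking_group \<alpha> \<tau>)"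
  using assms by (auto simp: generator_def linking_group_def FactGroup_def RCOSETS_def)

lemma generator_involution:
  assumes "\<tau> \<in> \<alpha> \<rightarrow> \<alpha>" "a \<in> \<alpha>"
  shows "generator \<alpha> \<tau> (\<tau> a) \<otimes>\<^bsub>linking_group \<alpha> \<tau>\<^esub> generator \<alpha> \<tau> a = \<one>\<^bsub>linking_group \<alpha> \<tau>\<^esub>"
proof -
  let ?F = "free_Abelian_group \<alpha>" and ?N = "linking_relations \<alpha> \<tau>"
  interpret normal ?N ?F using assms by (intro linking_relations_normal)
  have "\<tau> a \<in> \<alpha>" using assms by auto
  then have "(?N #>\<^bsub>?F\<^esub> frag_of (\<tau> a)) <#>\<^bsub>?F\<^esub> (?N #>\<^bsub>?F\<^esub> frag_of a) =
      ?N #>\<^bsub>?F\<^esub> (frag_of (\<tau> a) + frag_of a)"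
    using assms rcos_sum[of "frag_of (\<tau> a)" "frag_of a"] by simp
  also have "\<dots> = ?N"
  proof (rule coset_join2)
    show "frag_of (\<tau> a) + frag_of a \<in> ?N"
      unfolding linking_relations_def
      by (rule generate.incl) (use assms in \<open>auto simp: add.commute\<close>)
    then show "frag_of (\<tau> a) + frag_of a \<in> carrier ?F"
      using subset by blast
  qed (use is_subgroup in auto)
  finally show ?thesis
    by (simp add: generator_def linking_group_def FactGroup_def)
qed

text \<open>The parity of the sum of all coefficients is a homomorphism that kills every relation
  \<open>b + \<tau>(b)\<close>, but not a single generator.\<close>

lemma generator_nontrivial:
  assumes "\<tau> \<in> \<alpha> \<rightarrow> \<alpha>" "a \<in> \<alpha>"
  shows "generator \<alpha> \<tau> a \<noteq> \<one>\<^bsub>linking_group \<alpha> \<tau>\<^esub>"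
proof
  let ?F = "free_Abelian_group \<alpha>" and ?N = "linking_relations \<alpha> \<tau>"
  \<comment> \<open>The sum of the coefficients, obtained by sending all generators to one.\<close>
  define total where "total u = Poly_Mapping.lookup (frag_extend (\<lambda>_. frag_of ()) u) ()"
    for u :: "'a \<Rightarrow>\<^sub>0 int"
  have total_add: "total (u + w) = total u + total w"
    and total_minus: "total (- u) = - total u" for u w
    by (simp_all add: total_def frag_extend_add frag_extend_minus Poly_Mapping.lookup_add)
  have total_of: "total (frag_of b) = 1" for b
    by (simp add: total_def)
  assume "generator \<alpha> \<tau> a = \<one>\<^bsub>linking_group \<alpha> \<tau>\<^esub>"
  then have "?N #>\<^bsub>?F\<^esub> frag_of a = ?N"
    by (simp add: generator_def linking_group_def FactGroup_def)
  then have "frag_of a \<in> ?N"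
    by (rule group.coset_join1[OF group_free_Abelian_group])
       (use assms linking_relations_subgroup in auto)
  moreover have "even (total u)" if "u \<in> ?N" for u
    using that unfolding linking_relations_def
  proof (induction rule: generate.induct)
    case (inv h)
    then obtain b where "b \<in> \<alpha>" "h = frag_of b + frag_of (\<tau> b)" by auto
    moreover from this have "Poly_Mapping.keys h \<subseteq> \<alpha>"
      using assms keys_add[of "frag_of b" "frag_of (\<tau> b)"] by auto
    ultimately show ?case
      by (simp add: total_minus total_add total_of del: minus_add_distrib)
  qed (auto simp: total_add total_of, simp add: total_def)
  ultimately show False
    using total_of[of a] by fastforce
qed

section \<open>Linking numbers\<close>

lemma linking_number_eq:
  assumes "i \<noteq> j"
  shows "linking_number \<alpha> \<tau> p (Suc i) (Suc j) =
    finprod (linking_group \<alpha> \<tau>) (\<lambda>A. generator \<alpha> \<tau> (the (snd p A)))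
      (component_letters (fst p) i \<inter> component_letters (fst p) j)"
  using assms by (simp add: linking_number_def shared_letters_eq)

lemma letter_value_closed:
  assumes "p \<in> nanophrases \<alpha> r" "A \<in> letters (fst p)"
  shows "the (snd p A) \<in> \<alpha>"
proof -
  obtain w f where p: "p = (w, f)" by (cases p)
  then obtain a where "f A = Some a"
    using assms by (auto simp: nanophrases_def)
  then show ?thesis
    using assms p by (auto simp: nanophrases_def ran_def)
qed

lemma linking_number_closed:
  assumes "\<tau> \<in> \<alpha> \<rightarrow> \<alpha>" "p \<in> nanophrases \<alpha> r"
  shows "linking_number \<alpha> \<tau> p (Suc i) (Suc j) \<in> carrier (linking_group \<alpha> \<tau>)"
proof (cases "i = j")
  interpret comm_group "linking_group \<alpha> \<tau>" using assms by (intro comm_group_linking_group)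
  case False
  then show ?thesis
    unfolding linking_number_eq[OF False]
    using component_letters_subset assms
    by (intro finprod_closed) (auto intro!: generator_closed letter_value_closed)
next
  interpret comm_group "linking_group \<alpha> \<tau>" using assms by (intro comm_group_linking_group)
  case True
  then show ?thesis by (simp add: linking_number_def)
qed

text \<open>The contribution of one letter splits off, which expresses both the effect of the deleting
  moves and the differences given by semi-letters.\<close>

lemma linking_number_delete_letter:
  assumes "\<tau> \<in> \<alpha> \<rightarrow> \<alpha>" "p \<in> nanophrases \<alpha> r" "i \<noteq> j"
  shows "linking_number \<alpha> \<tau> p (Suc i) (Suc j) =
    (if A \<in> component_letters (fst p) i \<inter> component_letters (fst p) j
     then generator \<alpha> \<tau> (the (snd p A)) else \<one>\<^bsub>linking_group \<alpha> \<tau>\<^esub>)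
    \<otimes>\<^bsub>linking_group \<alpha> \<tau>\<^esub> linking_number \<alpha> \<tau> (delete_letter A p) (Suc i) (Suc j)"
proof -
  interpret comm_group "linking_group \<alpha> \<tau>" using assms by (intro comm_group_linking_group)
  let ?sh = "component_letters (fst p) i \<inter> component_letters (fst p) j"
  let ?g = "\<lambda>A. generator \<alpha> \<tau> (the (snd p A))"
  have g: "?g B \<in> carrier (linking_group \<alpha> \<tau>)" if "B \<in> ?sh" for B
    using that assms component_letters_subset
    by (auto intro!: generator_closed letter_value_closed)
  have fin: "finite ?sh"
    using component_letters_subset finite_letters by (meson finite_Int finite_subset)
  have del: "linking_number \<alpha> \<tau> (delete_letter A p) (Suc i) (Suc j) =
      finprod (linking_group \<alpha> \<tau>) ?g (?sh - {A})"
  proof -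
    have "component_letters (fst (delete_letter A p)) i \<inter>
        component_letters (fst (delete_letter A p)) j = ?sh - {A}"
      by (auto simp: delete_letter_def component_letters_filter)
    then show ?thesis
      unfolding linking_number_eq[OF assms(3)]
      by (intro finprod_cong) (auto simp: delete_letter_def g)
  qed
  show ?thesis
  proof (cases "A \<in> ?sh")
    case True
    have "finprod (linking_group \<alpha> \<tau>) ?g (insert A (?sh - {A})) =
        ?g A \<otimes>\<^bsub>linking_group \<alpha> \<tau>\<^esub> finprod (linking_group \<alpha> \<tau>) ?g (?sh - {A})"
      using fin True g by (intro finprod_insert) auto
    then show ?thesis
      using True by (simp add: del linking_number_eq[OF assms(3), of \<alpha> \<tau> p] insert_absorb)
  next
    case False
    then have "?sh - {A} = ?sh" by auto
    moreover have "finprod (linking_group \<alpha> \<tau>) ?g ?sh \<in> carrier (linking_group \<alpha> \<tau>)"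
      using g by (intro finprod_closed) auto
    ultimately show ?thesis
      unfolding if_not_P[OF False] by (simp add: del linking_number_eq[OF assms(3), of \<alpha> \<tau> p])
  qed
qed

text \<open>The requirement that both sides of a move are nanophrases enters through the multiplicity
  \<open>2\<close> of each letter: it keeps the displayed letters out of the remaining words.\<close>

lemma linking_number_move:
  assumes \<tau>: "\<tau> \<in> \<alpha> \<rightarrow> \<alpha>"
    and "p \<in> nanophrases \<alpha> r" "q \<in> nanophrases \<alpha> r" "homotopy_move \<tau> S p q" "i \<noteq> j"
  shows "linking_number \<alpha> \<tau> p (Suc i) (Suc j) = linking_number \<alpha> \<tau> q (Suc i) (Suc j)"
proof -
  interpret comm_group "linking_group \<alpha> \<tau>" using \<tau> by (rule comm_group_linking_group)
  have count: "count_list w (Letter A) = (if A \<in> letters w then 2 else 0)"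
    if "(w, f) \<in> nanophrases \<alpha> r" for w f A
    using that by (auto simp: nanophrases_def gauss_phrase_def letters_def count_list_0_iff)
  have absent: "A \<notin> letters w" if "count_list w (Letter A) = 0" for A w
    using that by (simp add: letters_def count_list_0_iff)
  have absent_comp: "A \<notin> component_letters w k" if "count_list w (Letter A) = 0" for A w k
    using absent[OF that] component_letters_subset by blast
  have filter_absent: "filter (\<lambda>s. s \<noteq> Letter A) w = w" if "count_list w (Letter A) = 0" for A w
    using that by (auto simp: filter_id_conv count_list_0_iff)
  from assms(4) show ?thesis
  proof cases
    case (isomorphism h w w' f' f)
    let ?sh = "component_letters w i \<inter> component_letters w j"
    have sub: "?sh \<subseteq> letters w" using component_letters_subset by blast
    have inj: "inj_on h (letters w)" using isomorphism by (simp add: bij_betw_def)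
    have "component_letters w' i \<inter> component_letters w' j = h ` ?sh"
      using inj_on_image_Int[OF inj component_letters_subset component_letters_subset, of i j]
      by (simp add: isomorphism component_letters_map)
    moreover have "generator \<alpha> \<tau> (the (f' B)) \<in> carrier (linking_group \<alpha> \<tau>)" if "B \<in> h ` ?sh" for B
    proof -
      have "B \<in> letters w'"
        using that sub isomorphism by (auto simp: bij_betw_def)
      then show ?thesis
        using assms letter_value_closed[OF assms(3)] isomorphism by (auto intro: generator_closed)
    qed
    moreover have "finprod (linking_group \<alpha> \<tau>) (\<lambda>A. generator \<alpha> \<tau> (the (f' (h A)))) ?sh =
        finprod (linking_group \<alpha> \<tau>) (\<lambda>A. generator \<alpha> \<tau> (the (f A))) ?sh"
      using subsetD[OF sub] isomorphism letter_value_closed[OF assms(2)]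
      by (intro finprod_cong) (auto simp: simp_implies_def intro!: generator_closed[OF \<tau>])
    ultimately show ?thesis
      using finprod_reindex[of "\<lambda>A. generator \<alpha> \<tau> (the (f' A))" h ?sh] inj_on_subset[OF inj sub]
      by (simp add: isomorphism linking_number_eq[OF assms(5)] Pi_def)
  next
    case (H1 x A y f)
    have c: "count_list x (Letter A) = 0" "count_list y (Letter A) = 0"
      using count[of "x @ [Letter A, Letter A] @ y" f A] assms(2) H1
      by (auto simp: letters_def)
    have q: "q = delete_letter A p"
      using c by (simp add: H1 delete_letter_def filter_absent)
    have not_shared: "A \<notin> component_letters (fst p) i \<inter> component_letters (fst p) j"
      using assms(5) c by (auto simp: H1 component_letters_append absent_comp split: if_splits)
    show ?thesis
      using linking_number_delete_letter[OF \<tau> assms(2,5), of A] linking_number_closed[OF \<tau> assms(3)]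
      unfolding if_not_P[OF not_shared] by (simp add: q)
  next
    case (H2 f A a B b x y z)
    note cA = count[of "fst p" f A] and cB = count[of "fst p" f B]
    have AB: "A \<noteq> B"
      using cA assms(2) H2 by (auto simp: letters_def)
    have c: "count_list x (Letter A) = 0" "count_list y (Letter A) = 0" "count_list z (Letter A) = 0"
        "count_list x (Letter B) = 0" "count_list y (Letter B) = 0" "count_list z (Letter B) = 0"
      using cA cB assms(2) H2 AB by (auto simp: letters_def)
    let ?p' = "delete_letter A p"
    have p': "?p' \<in> nanophrases \<alpha> r"
      using assms by (simp add: delete_letter_nanophrase)
    \<comment> \<open>The move H2 is carried out as two deletions, and the contributions cancel.\<close>
    have q: "q = delete_letter B ?p'"
      using c AB by (auto simp: H2 delete_letter_def filter_absent restrict_map_def fun_eq_iff)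
    have "a \<in> \<alpha>" "b \<in> \<alpha>"
      using assms(2) H2 by (auto simp: nanophrases_def ran_def)
    then have cancel: "generator \<alpha> \<tau> a \<otimes>\<^bsub>linking_group \<alpha> \<tau>\<^esub> generator \<alpha> \<tau> b = \<one>\<^bsub>linking_group \<alpha> \<tau>\<^esub>"
      and closed: "generator \<alpha> \<tau> a \<in> carrier (linking_group \<alpha> \<tau>)"
        "generator \<alpha> \<tau> b \<in> carrier (linking_group \<alpha> \<tau>)"
      using generator_involution[OF \<tau>, of b] generator_closed[OF \<tau>] H2 by simp_all
    have same: "A \<in> component_letters (fst p) k \<longleftrightarrow> B \<in> component_letters (fst ?p') k" for k
    proof -
      have "A \<in> component_letters (fst p) k \<longleftrightarrow>
          k = count_list x Bar \<or> k = count_list x Bar + count_list y Bar"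
        using AB c by (auto simp: H2 mem_component_letters_append absent_comp
            mem_component_letters_Letter simp del: component_letters.simps(2))
      moreover have "B \<in> component_letters (fst p) k \<longleftrightarrow>
          k = count_list x Bar \<or> k = count_list x Bar + count_list y Bar"
        using AB c by (auto simp: H2 mem_component_letters_append absent_comp
            mem_component_letters_Letter simp del: component_letters.simps(2))
      ultimately show ?thesis
        using AB by (simp add: delete_letter_def component_letters_filter)
    qed
    have val: "the (snd p A) = a" "the (snd ?p' B) = b"
      using AB by (auto simp: H2 delete_letter_def)
    let ?l = "\<lambda>p. linking_number \<alpha> \<tau> p (Suc i) (Suc j)"
    have l_q: "?l (delete_letter B ?p') \<in> carrier (linking_group \<alpha> \<tau>)"
      using linking_number_closed[OF \<tau> assms(3)] by (simp add: q)
    note del_A = linking_number_delete_letter[OF \<tau> assms(2,5), of A]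
      and del_B = linking_number_delete_letter[OF \<tau> p' assms(5), of B]
    have "?l p = ?l (delete_letter B ?p')"
    proof (cases "B \<in> component_letters (fst ?p') i \<inter> component_letters (fst ?p') j")
      case True
      then have "A \<in> component_letters (fst p) i \<inter> component_letters (fst p) j"
        by (simp only: Int_iff same simp_thms)
      then have "?l p = generator \<alpha> \<tau> a \<otimes>\<^bsub>linking_group \<alpha> \<tau>\<^esub>
          (generator \<alpha> \<tau> b \<otimes>\<^bsub>linking_group \<alpha> \<tau>\<^esub> ?l (delete_letter B ?p'))"
        using del_A del_B True by (simp only: if_True val)
      also have "\<dots> = ?l (delete_letter B ?p')"
        using closed l_q cancel by (simp flip: m_assoc)
      finally show ?thesis .
    next
      case False
      then have "A \<notin> component_letters (fst p) i \<inter> component_letters (fst p) j"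
        by (simp only: Int_iff same simp_thms)
      then show ?thesis
        using del_A del_B False l_q by (simp only: if_False l_one)
    qed
    then show ?thesis
      by (simp only: q)
  next
    case (H3 f A a B b C c x y z t)
    have "component_letters (fst p) k = component_letters (fst q) k" for k
      by (auto simp: H3 component_letters_append)
    then show ?thesis
      by (simp add: linking_number_eq[OF assms(5)] H3)
  qed
qed

text \<open>Deleting \<open>A\<close> does not affect the contribution of \<open>B\<close>, so deleting \<open>B\<close> removes the same
  factor from the linking number before and after \<open>A\<close> is deleted.\<close>

lemma linking_number_second_difference:
  assumes \<tau>: "\<tau> \<in> \<alpha> \<rightarrow> \<alpha>" and p: "p \<in> nanophrases \<alpha> r" and "A \<noteq> B"
  shows "linking_number \<alpha> \<tau> p (Suc i) (Suc j) \<otimes>\<^bsub>linking_group \<alpha> \<tau>\<^esub>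
           linking_number \<alpha> \<tau> (delete_letter B (delete_letter A p)) (Suc i) (Suc j) =
         linking_number \<alpha> \<tau> (delete_letter A p) (Suc i) (Suc j) \<otimes>\<^bsub>linking_group \<alpha> \<tau>\<^esub>
           linking_number \<alpha> \<tau> (delete_letter B p) (Suc i) (Suc j)"
proof (cases "i = j")
  case True
  then show ?thesis by (simp add: linking_number_def)
next
  case False
  interpret comm_group "linking_group \<alpha> \<tau>" using \<tau> by (rule comm_group_linking_group)
  let ?pA = "delete_letter A p"
  let ?l = "\<lambda>p. linking_number \<alpha> \<tau> p (Suc i) (Suc j)"
  define g where "g = (if B \<in> component_letters (fst p) i \<inter> component_letters (fst p) j
     then generator \<alpha> \<tau> (the (snd p B)) else \<one>\<^bsub>linking_group \<alpha> \<tau>\<^esub>)"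
  have pA: "?pA \<in> nanophrases \<alpha> r" using p by (rule delete_letter_nanophrase)
  have g_closed: "g \<in> carrier (linking_group \<alpha> \<tau>)"
    using letter_value_closed[OF p] component_letters_subset
    by (auto simp: g_def intro!: generator_closed[OF \<tau>])
  have "?l p = g \<otimes>\<^bsub>linking_group \<alpha> \<tau>\<^esub> ?l (delete_letter B p)"
    using linking_number_delete_letter[OF \<tau> p False] by (simp add: g_def)
  moreover have "?l ?pA = g \<otimes>\<^bsub>linking_group \<alpha> \<tau>\<^esub> ?l (delete_letter B ?pA)"
    using linking_number_delete_letter[OF \<tau> pA False, of B] \<open>A \<noteq> B\<close>
    by (simp add: g_def delete_letter_def component_letters_filter)
  moreover have "?l (delete_letter B p) \<in> carrier (linking_group \<alpha> \<tau>)"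
      "?l (delete_letter B ?pA) \<in> carrier (linking_group \<alpha> \<tau>)"
    using linking_number_closed[OF \<tau>] delete_letter_nanophrase p pA by blast+
  ultimately show ?thesis
    using g_closed by (simp add: m_ac)
qed

section \<open>The linking matrix\<close>

lemma comm_group_linking_matrix_group:
  assumes "\<tau> \<in> \<alpha> \<rightarrow> \<alpha>"
  shows "comm_group (linking_matrix_group \<alpha> \<tau> r)"
proof -
  interpret comm_group "linking_group \<alpha> \<tau>" using assms by (rule comm_group_linking_group)
  have "group (linking_matrix_group \<alpha> \<tau> r)"
    unfolding linking_matrix_group_def by simp
  then show ?thesis
    by (rule group.group_comm_groupI)
       (auto simp: linking_matrix_group_def PiE_def Pi_def fun_eq_iff m_comm)
qed

lemma matrix_index_Suc: "(i, j) \<in> {1..r} \<times> {1..r} \<Longrightarrow> \<exists>i' j'. i = Suc i' \<and> j = Suc j'"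
  by (auto simp: Suc_le_eq gr0_conv_Suc)

lemma linking_matrix_invariant:
  assumes "\<tau> \<in> \<alpha> \<rightarrow> \<alpha>"
  shows "homotopy_invariant \<alpha> \<tau> S r (linking_matrix_group \<alpha> \<tau> r) (linking_matrix \<alpha> \<tau> r)"
proof (rule homotopy_invariantI)
  show "linking_matrix \<alpha> \<tau> r \<in> nanophrases \<alpha> r \<rightarrow> carrier (linking_matrix_group \<alpha> \<tau> r)"
    using linking_number_closed[OF assms] matrix_index_Suc
    by (fastforce simp: linking_matrix_def linking_matrix_group_def)
next
  fix p q :: "'a nanophrase"
  assume pq: "p \<in> nanophrases \<alpha> r" "q \<in> nanophrases \<alpha> r" "homotopy_move \<tau> S p q"
  have "linking_number \<alpha> \<tau> p i j = linking_number \<alpha> \<tau> q i j" if "(i, j) \<in> {1..r} \<times> {1..r}" for i j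
    using matrix_index_Suc[OF that] linking_number_move[OF assms pq]
    by (cases "i = j") (auto simp: linking_number_def)
  then show "linking_matrix \<alpha> \<tau> r p = linking_matrix \<alpha> \<tau> r q"
    by (auto simp: linking_matrix_def fun_eq_iff)
qed (rule comm_group_linking_matrix_group[OF assms])

lemma linking_matrix_vanishes_above_1:
  assumes "\<tau> \<in> \<alpha> \<rightarrow> \<alpha>"
  shows "vanishes_above \<alpha> \<tau> S r (linking_matrix_group \<alpha> \<tau> r) (linking_matrix \<alpha> \<tau> r) 1"
proof (rule vanishes_above_1I[OF linking_matrix_invariant[OF assms]])
  fix p :: "'a nanophrase" and A B :: nat
  assume p: "p \<in> nanophrases \<alpha> r" and "A \<noteq> B"
  let ?L = "linking_matrix \<alpha> \<tau> r" and ?G = "linking_matrix_group \<alpha> \<tau> r"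
  have "linking_number \<alpha> \<tau> p i j \<otimes>\<^bsub>linking_group \<alpha> \<tau>\<^esub>
          linking_number \<alpha> \<tau> (delete_letter B (delete_letter A p)) i j =
        linking_number \<alpha> \<tau> (delete_letter A p) i j \<otimes>\<^bsub>linking_group \<alpha> \<tau>\<^esub>
          linking_number \<alpha> \<tau> (delete_letter B p) i j" if "(i, j) \<in> {1..r} \<times> {1..r}" for i j
    using matrix_index_Suc[OF that] linking_number_second_difference[OF assms p \<open>A \<noteq> B\<close>] by auto
  then show "?L p \<otimes>\<^bsub>?G\<^esub> ?L (delete_letter B (delete_letter A p)) =
      ?L (delete_letter A p) \<otimes>\<^bsub>?G\<^esub> ?L (delete_letter B p)"
    by (auto simp: linking_matrix_def linking_matrix_group_def fun_eq_iff)
qed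

lemma linking_matrix_not_vanishes_above_0:
  assumes \<tau>: "\<tau> \<in> \<alpha> \<rightarrow> \<alpha>" and "a \<in> \<alpha>" "2 \<le> r"
  shows "\<not> vanishes_above \<alpha> \<tau> S r (linking_matrix_group \<alpha> \<tau> r) (linking_matrix \<alpha> \<tau> r) 0"
proof
  let ?L = "linking_matrix \<alpha> \<tau> r" and ?G = "linking_matrix_group \<alpha> \<tau> r"
  interpret comm_group "linking_group \<alpha> \<tau>" using \<tau> by (rule comm_group_linking_group)
  interpret G: comm_group ?G using \<tau> by (rule comm_group_linking_matrix_group)
  obtain k where r: "r = Suc (Suc k)"
    using \<open>2 \<le> r\<close> by (metis Suc_diff_le add_2_eq_Suc le_add_diff_inverse)
  \<comment> \<open>One letter in the first and the last component, the other components being empty.\<close>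
  define p :: "'a nanophrase" where
    "p = (Letter 0 # replicate (Suc k) Bar @ [Letter 0], [0 \<mapsto> a])"
  let ?q = "delete_letter 0 p"
  have count: "count_list (replicate n Bar) s = (if s = Bar then n else 0)"
    for n and s :: "nat symbol"
    by (induction n) auto
  have letters: "letters (fst p) = {0}"
    by (auto simp: p_def letters_def)
  have p: "p \<in> nanophrases \<alpha> r"
    using letters \<open>a \<in> \<alpha>\<close> by (auto simp: p_def nanophrases_def gauss_phrase_def r count)
  have q: "?q \<in> nanophrases \<alpha> r"
    using p by (rule delete_letter_nanophrase)
  note inv = linking_matrix_invariant[OF \<tau>, of S r]
  have closed: "?L p \<in> carrier ?G" "?L ?q \<in> carrier ?G"
    using inv p q by (auto simp: homotopy_invariant_def)
  assume "vanishes_above \<alpha> \<tau> S r ?G ?L 0"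
  moreover have "distinct [0::nat] \<and> set [0] \<subseteq> letters (fst p) \<and> 0 < length [0::nat]"
    by (simp add: letters)
  ultimately have "linear_extension ?G ?L (semi \<alpha> \<tau> S r p [0]) = \<one>\<^bsub>?G\<^esub>"
    using p unfolding vanishes_above_def by blast
  then have "?L p \<otimes>\<^bsub>?G\<^esub> inv\<^bsub>?G\<^esub> ?L ?q = \<one>\<^bsub>?G\<^esub>"
    by (simp only: linear_extension_semi_Cons[OF inv p] linear_extension_semi_Nil[OF inv p]
        linear_extension_semi_Nil[OF inv q])
  then have "?L p = ?L ?q"
    using closed by (simp add: G.inv_solve_right')
  then have "?L p (Suc 0, Suc (Suc k)) = ?L ?q (Suc 0, Suc (Suc k))"
    by simp
  then have "linking_number \<alpha> \<tau> p (Suc 0) (Suc (Suc k)) = linking_number \<alpha> \<tau> ?q (Suc 0) (Suc (Suc k))"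
    by (simp add: linking_matrix_def r)
  moreover have "linking_number \<alpha> \<tau> ?q (Suc 0) (Suc (Suc k)) = \<one>\<^bsub>linking_group \<alpha> \<tau>\<^esub>"
  proof -
    have "component_letters (fst ?q) n = {}" for n
      using component_letters_subset[of "fst ?q" n] letters by (auto simp: letters_delete_letter)
    then show ?thesis
      by (simp add: linking_number_eq)
  qed
  moreover have "0 \<in> component_letters (fst p) 0 \<inter> component_letters (fst p) (Suc k)"
    by (auto simp: p_def component_letters_append count)
  ultimately have "generator \<alpha> \<tau> a = \<one>\<^bsub>linking_group \<alpha> \<tau>\<^esub>"
    using linking_number_delete_letter[OF \<tau> p, of 0 "Suc k" 0] generator_closed[OF \<tau> \<open>a \<in> \<alpha>\<close>]
    by (simp add: p_def)
  then show False
    using generator_nontrivial[OF \<tau> \<open>a \<in> \<alpha>\<close>] by contradiction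
qed

theorem theorem6p1:
  fixes \<alpha> :: "'a set" and \<tau> :: "'a \<Rightarrow> 'a" and S :: "('a \<times> 'a \<times> 'a) set" and r :: nat
  assumes "finite \<alpha>"
    and "\<tau> \<in> \<alpha> \<rightarrow> \<alpha>" and "\<forall>a\<in>\<alpha>. \<tau> (\<tau> a) = a"
    and "S \<subseteq> \<alpha> \<times> \<alpha> \<times> \<alpha>"
    and "r \<ge> 1"
  shows "finite_type_invariant \<alpha> \<tau> S r
           (linking_matrix_group \<alpha> \<tau> r) (linking_matrix \<alpha> \<tau> r) \<and>
         invariant_degree \<alpha> \<tau> S r
           (linking_matrix_group \<alpha> \<tau> r) (linking_matrix \<alpha> \<tau> r) \<le> 1 \<and>
         (r \<ge> 2 \<and> \<alpha> \<noteq> {} \<longrightarrow>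
           invariant_degree \<alpha> \<tau> S r
             (linking_matrix_group \<alpha> \<tau> r) (linking_matrix \<alpha> \<tau> r) = 1)"
proof (intro conjI impI)
  let ?van = "vanishes_above \<alpha> \<tau> S r (linking_matrix_group \<alpha> \<tau> r) (linking_matrix \<alpha> \<tau> r)"
  have above: "?van 1"
    using assms(2) by (rule linking_matrix_vanishes_above_1)
  show "finite_type_invariant \<alpha> \<tau> S r (linking_matrix_group \<alpha> \<tau> r) (linking_matrix \<alpha> \<tau> r)"
    using above linking_matrix_invariant[OF assms(2)] by (auto simp: finite_type_invariant_def)
  show le: "invariant_degree \<alpha> \<tau> S r (linking_matrix_group \<alpha> \<tau> r) (linking_matrix \<alpha> \<tau> r) \<le> 1"
    unfolding invariant_degree_def using above by (rule Least_le)
  assume "r \<ge> 2 \<and> \<alpha> \<noteq> {}"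
  then have "\<not> ?van 0"
    using linking_matrix_not_vanishes_above_0[OF assms(2)] by blast
  moreover have "?van (invariant_degree \<alpha> \<tau> S r (linking_matrix_group \<alpha> \<tau> r) (linking_matrix \<alpha> \<tau> r))"
    unfolding invariant_degree_def using above by (rule LeastI)
  ultimately show "invariant_degree \<alpha> \<tau> S r (linking_matrix_group \<alpha> \<tau> r) (linking_matrix \<alpha> \<tau> r) = 1"
    using le by (metis le_antisym less_one linorder_not_le)
qed

end
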